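(* Let $m,n$ be positive integers such that $m(m+1)<2\lceil n/2\rceil$, and write $[a,b]=\{a,a+1,\ldots,b\}$. Then \[ \ell_q([m,n])=\ell_q([1,n])=\frac12\left(\frac{n(n+1)}{2}+\left\lceil\frac n2\right\rceil\right). \]
   Context: All graphs are finite and simple. The degree set of a graph is the set of distinct degrees of its vertices. For a finite nonempty set $\mathscr D$ of positive integers, $\ell_q(\mathscr D)$ denotes the least number of edges of a simple graph whose degree set is exactly $\mathscr D$. *)

theory Defs
  imports Complex_Main
begin

definition simple_graph :: "'a set \<Rightarrow> 'a set set \<Rightarrow> bool" where
  "simple_graph V E \<longleftrightarrow> finite V \<and> (\<forall>e\<in>E. e \<subseteq> V \<and> card e = 2)"

definition degree :: "'a set set \<Rightarrow> 'a \<Rightarrow> nat" where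
  "degree E v = card {e \<in> E. v \<in> e}"

definition degree_set :: "'a set \<Rightarrow> 'a set set \<Rightarrow> nat set" where
  "degree_set V E = degree E ` V"

text \<open>Vertices are natural numbers; by \<open>simple_graph_relabel_nat\<close> below this is no
  restriction on the graphs considered.\<close>

definition lq :: "nat set \<Rightarrow> nat" where
  "lq D = (LEAST q. \<exists>(V :: nat set) E. simple_graph V E \<and> degree_set V E = D \<and> card E = q)"

lemma simple_graph_relabel_nat:
  fixes V :: "'a set"
  assumes "simple_graph V E"
  shows "\<exists>(V' :: nat set) E'. simple_graph V' E' \<and> degree_set V' E' = degree_set V E
           \<and> card E' = card E"
proof -
  have fin: "finite V" and E: "\<And>e. e \<in> E \<Longrightarrow> e \<subseteq> V \<and> card e = 2"
    using assms by (auto simp: simple_graph_def)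
  obtain f :: "'a \<Rightarrow> nat" where f: "inj_on f V"
    using finite_imp_inj_to_nat_seg[OF fin] by blast
  have inj: "inj_on (image f) E"
    using E f by (meson inj_on_def inj_on_image_eq_iff)
  have sg: "simple_graph (f ` V) (image f ` E)"
    unfolding simple_graph_def
  proof (intro conjI ballI)
    fix e assume "e \<in> image f ` E"
    then obtain d where d: "d \<in> E" "e = f ` d" by blast
    show "e \<subseteq> f ` V" using d E by blast
    show "card e = 2" using d E f by (metis card_image inj_on_subset)
  qed (use fin in simp)
  have deg: "degree (image f ` E) (f v) = degree E v" if v: "v \<in> V" for v
  proof -
    have "{e \<in> image f ` E. f v \<in> e} = image f ` {e \<in> E. v \<in> e}"
      using inj_on_image_mem_iff[OF f v] E by blast
    moreover have "inj_on (image f) {e \<in> E. v \<in> e}"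
      using inj by (rule inj_on_subset) auto
    ultimately show ?thesis by (simp add: degree_def card_image)
  qed
  have "degree_set (f ` V) (image f ` E) = degree_set V E"
    using deg by (simp add: degree_set_def image_image)
  with sg show ?thesis using card_image[OF inj] by blast
qed

end

theory Submission
  imports Defs "HOL-Combinatorics.Transposition"
begin

text \<open>Put \<open>k = \<lceil>n/2\<rceil>\<close>; the common value is \<open>k (n + 1 - k)\<close>. For the lower bound, take one vertex of
  each of the \<open>k\<close> largest degrees \<open>n - k + 1, \<dots>, n\<close>: each edge is counted at most twice in the sum of
  these degrees, and at most \<open>k choose 2\<close> edges are counted twice. For the upper bound, start with the
  antiregular graph on \<open>n + 1\<close> vertices, whose degrees are \<open>1, \<dots>, n\<close> with \<open>k\<close> repeated. Moving the end
  of an edge from a vertex of larger degree to one of smaller degree keeps the number of edges, so one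
  of the two vertices of degree \<open>k\<close> can raise the degrees \<open>1, \<dots>, m - 1\<close> to \<open>m\<close>; it loses
  \<open>m (m - 1) / 2\<close> in the process and still has degree at least \<open>m\<close>.\<close>

definition neighbours :: "'a set set \<Rightarrow> 'a \<Rightarrow> 'a set" where
  "neighbours E v = {w. {v, w} \<in> E}"

lemma neighbours_commute: "w \<in> neighbours E v \<longleftrightarrow> v \<in> neighbours E w"
  by (simp add: neighbours_def insert_commute)

lemma simple_graph_finite_edges:
  assumes "simple_graph V E"
  shows "finite E"
proof (rule finite_subset)
  show "E \<subseteq> Pow V" "finite (Pow V)" using assms by (auto simp: simple_graph_def)
qed

lemma neighbours_subset:
  assumes "simple_graph V E"
  shows "neighbours E v \<subseteq> V - {v}"
  using assms by (force simp: simple_graph_def neighbours_def)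

lemma finite_neighbours:
  assumes "simple_graph V E"
  shows "finite (neighbours E v)"
  using neighbours_subset[OF assms] assms
  by (meson finite_Diff finite_subset simple_graph_def)

lemma degree_eq_card_neighbours:
  assumes "simple_graph V E"
  shows "degree E v = card (neighbours E v)"
proof -
  have "{e \<in> E. v \<in> e} = (\<lambda>w. {v, w}) ` neighbours E v"
  proof (intro equalityI subsetI)
    fix e assume e: "e \<in> {e \<in> E. v \<in> e}"
    then have "card e = 2" using assms by (simp add: simple_graph_def)
    then obtain x y where "e = {x, y}" by (auto simp: card_2_iff)
    with e obtain w where "e = {v, w}" by (auto simp: insert_commute)
    with e show "e \<in> (\<lambda>w. {v, w}) ` neighbours E v" by (auto simp: neighbours_def)
  qed (auto simp: neighbours_def)
  moreover have "inj_on (\<lambda>w. {v, w}) (neighbours E v)"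
    by (auto simp: inj_on_def doubleton_eq_iff)
  ultimately show ?thesis by (simp add: degree_def card_image)
qed

lemma sum_degree_eq_sum_card_Int:
  assumes "finite S" "finite E"
  shows "(\<Sum>v\<in>S. degree E v) = (\<Sum>e\<in>E. card (e \<inter> S))"
proof -
  have "(\<Sum>v\<in>S. degree E v) = (\<Sum>v\<in>S. \<Sum>e\<in>E. if v \<in> e then 1 else 0)"
    using assms by (simp add: degree_def sum.If_cases Int_def)
  also have "\<dots> = (\<Sum>e\<in>E. \<Sum>v\<in>S. if v \<in> e then 1 else 0)"
    by (rule sum.swap)
  also have "\<dots> = (\<Sum>e\<in>E. card (e \<inter> S))"
    using assms by (simp add: sum.If_cases Int_def conj_commute)
  finally show ?thesis .
qed

lemma sum_degree_eq_double_card_edges: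
  assumes "simple_graph V E"
  shows "(\<Sum>v\<in>V. degree E v) = 2 * card E"
proof -
  have "(\<Sum>v\<in>V. degree E v) = (\<Sum>e\<in>E. card (e \<inter> V))"
    using assms simple_graph_finite_edges
    by (intro sum_degree_eq_sum_card_Int) (auto simp: simple_graph_def)
  also have "\<dots> = (\<Sum>e\<in>E. 2)"
    using assms by (intro sum.cong) (auto simp: simple_graph_def Int_absorb2)
  finally show ?thesis by simp
qed

lemma sum_degree_le_card_edges_add_choose:
  assumes graph: "simple_graph V E" and "finite S"
  shows "(\<Sum>v\<in>S. degree E v) \<le> card E + (card S choose 2)"
proof -
  have "finite E" by (rule simple_graph_finite_edges[OF graph])
  have card_Int_le: "card (e \<inter> S) \<le> 1 + of_bool (e \<subseteq> S)" if "e \<in> E" for e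
  proof (cases "e \<subseteq> S")
    case True
    with that graph show ?thesis by (simp add: Int_absorb2 simple_graph_def)
  next
    case False
    have card_e: "card e = 2" using that graph by (simp add: simple_graph_def)
    then have "finite e" by (auto intro: card_ge_0_finite)
    moreover have "e \<inter> S \<subset> e" using False by blast
    ultimately have "card (e \<inter> S) < card e" by (rule psubset_card_mono)
    then show ?thesis using card_e by simp
  qed
  have "(\<Sum>v\<in>S. degree E v) = (\<Sum>e\<in>E. card (e \<inter> S))"
    using \<open>finite S\<close> \<open>finite E\<close> by (rule sum_degree_eq_sum_card_Int)
  also have "\<dots> \<le> (\<Sum>e\<in>E. 1 + of_bool (e \<subseteq> S))"
    by (intro sum_mono card_Int_le)
  also have "\<dots> = card E + card {e \<in> E. e \<subseteq> S}"
    unfolding sum.distrib using \<open>finite E\<close> by (simp add: Int_def)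
  also have "card {e \<in> E. e \<subseteq> S} \<le> card {e. e \<subseteq> S \<and> card e = 2}"
    using graph \<open>finite S\<close> by (intro card_mono) (auto simp: simple_graph_def)
  also have "\<dots> = card S choose 2" by (rule n_subsets[OF \<open>finite S\<close>])
  finally show ?thesis by simp
qed

lemma sum_subset_degree_set_le_card_edges_add_choose:
  assumes graph: "simple_graph V E" and "D \<subseteq> degree_set V E"
  shows "\<Sum>D \<le> card E + (card D choose 2)"
proof -
  obtain S where "S \<subseteq> V" and inj: "inj_on (degree E) S" and D: "D = degree E ` S"
    using assms(2) by (auto simp: degree_set_def subset_image_inj)
  then have "finite S" using graph finite_subset by (auto simp: simple_graph_def)
  have "\<Sum>D = (\<Sum>v\<in>S. degree E v)"
    by (simp add: D sum.reindex[OF inj])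
  also have "\<dots> \<le> card E + (card S choose 2)"
    by (rule sum_degree_le_card_edges_add_choose[OF graph \<open>finite S\<close>])
  finally show ?thesis by (simp add: D card_image[OF inj])
qed

lemma sum_atLeastLessThan_add:
  fixes a r :: nat
  shows "\<Sum>{a..<a + r} = r * a + (r choose 2)"
  by (induction r) (simp_all add: numeral_2_eq_2)

lemma card_edges_ge_of_consecutive_degrees:
  assumes "simple_graph V E" and "{a..<a + r} \<subseteq> degree_set V E"
  shows "r * a \<le> card E"
  using sum_subset_degree_set_le_card_edges_add_choose[OF assms]
  by (simp add: sum_atLeastLessThan_add)

definition move_edge :: "'a \<Rightarrow> 'a \<Rightarrow> 'a \<Rightarrow> 'a set set \<Rightarrow> 'a set set" where
  "move_edge u v w E = insert {v, w} (E - {{u, w}})"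

lemma simple_graph_move_edge:
  assumes "simple_graph V E" "{u, w} \<in> E" "v \<in> V" "v \<noteq> w"
  shows "simple_graph V (move_edge u v w E)"
  using assms by (auto simp: simple_graph_def move_edge_def)

lemma card_move_edge:
  assumes "finite E" "{u, w} \<in> E" "{v, w} \<notin> E"
  shows "card (move_edge u v w E) = card E"
  using assms card_Suc_Diff1 by (fastforce simp: move_edge_def)

lemma degree_insert:
  assumes "finite E" "e \<notin> E"
  shows "degree (insert e E) x = degree E x + of_bool (x \<in> e)"
proof -
  have "{f \<in> insert e E. x \<in> f} = (if x \<in> e then insert e {f \<in> E. x \<in> f} else {f \<in> E. x \<in> f})"
    by auto
  with assms show ?thesis by (simp add: degree_def)
qed

lemma degree_move_edge:
  assumes "finite E" "{u, w} \<in> E" "{v, w} \<notin> E"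
  shows "degree (move_edge u v w E) x + of_bool (x \<in> {u, w}) = degree E x + of_bool (x \<in> {v, w})"
proof -
  have "degree (move_edge u v w E) x = degree (E - {{u, w}}) x + of_bool (x \<in> {v, w})"
    using assms unfolding move_edge_def by (intro degree_insert) auto
  moreover have "degree E x = degree (E - {{u, w}}) x + of_bool (x \<in> {u, w})"
    using degree_insert[of "E - {{u, w}}" "{u, w}"] assms by (simp add: insert_absorb)
  ultimately show ?thesis by simp
qed

lemma exists_private_neighbour:
  assumes graph: "simple_graph V E" and less: "degree E v < degree E u"
  shows "\<exists>w \<in> neighbours E u - neighbours E v. w \<noteq> v"
proof (rule ccontr)
  assume "\<not> ?thesis"
  then have shared: "w \<in> neighbours E v" if "w \<in> neighbours E u" "w \<noteq> v" for w
    using that by blast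
  have "transpose u v ` neighbours E u \<subseteq> neighbours E v"
  proof (rule image_subsetI)
    fix w assume w: "w \<in> neighbours E u"
    show "transpose u v w \<in> neighbours E v"
    proof (cases "w = v")
      case True
      with w show ?thesis by (simp add: neighbours_commute)
    next
      case False
      moreover have "w \<noteq> u" using w neighbours_subset[OF graph] by blast
      ultimately show ?thesis using shared[OF w] by (simp add: transpose_apply_other)
    qed
  qed
  then have "card (neighbours E u) \<le> card (neighbours E v)"
    using finite_neighbours[OF graph] by (intro card_inj_on_le[of "transpose u v"]) auto
  with less show False by (simp add: degree_eq_card_neighbours[OF graph])
qed

lemma transfer_edge:
  assumes graph: "simple_graph V E" and "v \<in> V" and less: "degree E v < degree E u"
  obtains E' where "simple_graph V E'" "card E' = card E"
    "degree E' u + 1 = degree E u" "degree E' v = degree E v + 1"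
    "\<And>x. x \<notin> {u, v} \<Longrightarrow> degree E' x = degree E x"
proof -
  obtain w where w: "w \<in> neighbours E u" "w \<notin> neighbours E v" "w \<noteq> v"
    using exists_private_neighbour[OF graph less] by blast
  then have edges: "{u, w} \<in> E" "{v, w} \<notin> E" by (simp_all add: neighbours_def)
  have distinct: "w \<noteq> u" "u \<noteq> v" using w(1) neighbours_subset[OF graph] less by auto
  have "finite E" by (rule simple_graph_finite_edges[OF graph])
  note degree_moved = degree_move_edge[OF this edges]
  show thesis
  proof
    show "simple_graph V (move_edge u v w E)"
      using w(3) by (intro simple_graph_move_edge graph edges \<open>v \<in> V\<close>) simp
    show "card (move_edge u v w E) = card E"
      by (intro card_move_edge \<open>finite E\<close> edges)
    show "degree (move_edge u v w E) u + 1 = degree E u"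
      using degree_moved[of u] distinct by simp
    show "degree (move_edge u v w E) v = degree E v + 1"
      using degree_moved[of v] distinct w(3) by simp
    show "degree (move_edge u v w E) x = degree E x" if "x \<notin> {u, v}" for x
      using degree_moved[of x] that by simp
  qed
qed

lemma transfer_edges:
  assumes "simple_graph V E" "v \<in> V" "degree E v + 2 * j \<le> degree E u"
  shows "\<exists>E'. simple_graph V E' \<and> card E' = card E \<and> degree E' u + j = degree E u
    \<and> degree E' v = degree E v + j \<and> (\<forall>x. x \<notin> {u, v} \<longrightarrow> degree E' x = degree E x)"
  using assms
proof (induction j arbitrary: E)
  case 0
  then show ?case by auto
next
  case (Suc j)
  then have "degree E v < degree E u" by simp
  with Suc.prems(1,2) obtain E1 where E1: "simple_graph V E1" "card E1 = card E"
    "degree E1 u + 1 = degree E u" "degree E1 v = degree E v + 1"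
    "\<And>x. x \<notin> {u, v} \<Longrightarrow> degree E1 x = degree E x"
    by (rule transfer_edge) blast
  have "degree E1 v + 2 * j \<le> degree E1 u" using Suc.prems(3) E1(3,4) by simp
  then obtain E2 where "simple_graph V E2" "card E2 = card E1" "degree E2 u + j = degree E1 u"
    "degree E2 v = degree E1 v + j" "\<forall>x. x \<notin> {u, v} \<longrightarrow> degree E2 x = degree E1 x"
    using Suc.IH[OF E1(1) Suc.prems(2)] by blast
  with E1 show ?case by (intro exI[of _ E2]) auto
qed

lemma redistribute_degrees:
  assumes "finite S" "simple_graph V E" "S \<subseteq> V" "u \<notin> S"
    and "\<And>v. v \<in> S \<Longrightarrow> degree E v + g v + sum g S \<le> degree E u"
  shows "\<exists>E'. simple_graph V E' \<and> card E' = card E \<and> degree E' u + sum g S = degree E u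
    \<and> (\<forall>v\<in>S. degree E' v = degree E v + g v)
    \<and> (\<forall>x. x \<notin> insert u S \<longrightarrow> degree E' x = degree E x)"
  using assms
proof (induction S arbitrary: E)
  case empty
  then show ?case by auto
next
  case (insert v S)
  have "v \<in> V" "degree E v + 2 * g v \<le> degree E u"
    using insert.prems(2) insert.prems(4)[of v] insert.hyps by simp_all
  then obtain E1 where E1: "simple_graph V E1" "card E1 = card E"
    "degree E1 u + g v = degree E u" "degree E1 v = degree E v + g v"
    "\<And>x. x \<notin> {u, v} \<Longrightarrow> degree E1 x = degree E x"
    using transfer_edges[OF insert.prems(1)] by blast
  have unchanged: "degree E1 x = degree E x" if "x \<in> S" for x
    using that insert.prems(3) insert.hyps(2) by (intro E1(5)) auto
  have "degree E1 x + g x + sum g S \<le> degree E1 u" if "x \<in> S" for x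
    using that insert.prems(4)[of x] insert.hyps E1(3) unchanged by simp
  then obtain E2 where E2: "simple_graph V E2" "card E2 = card E1"
    "degree E2 u + sum g S = degree E1 u" "\<forall>x\<in>S. degree E2 x = degree E1 x + g x"
    "\<forall>x. x \<notin> insert u S \<longrightarrow> degree E2 x = degree E1 x"
    using insert.IH[OF E1(1)] insert.prems(2,3) by auto
  have "degree E2 x = degree E x + g x" if "x \<in> insert v S" for x
    using that E1(4) E2(4,5) unchanged insert.prems(3) insert.hyps(2) by (cases "x = v") auto
  with E1 E2 insert.hyps show ?case by (intro exI[of _ E2]) auto
qed

definition antiregular :: "nat \<Rightarrow> nat set set" where
  "antiregular N = {{i, j} |i j. i \<in> {1..N} \<and> j \<in> {1..N} \<and> i \<noteq> j \<and> N < i + j}"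

lemma simple_graph_antiregular: "simple_graph {1..N} (antiregular N)"
  by (auto simp: simple_graph_def antiregular_def)

lemma neighbours_antiregular:
  assumes "i \<in> {1..N}"
  shows "neighbours (antiregular N) i = {Suc N - i..N} - {i}"
proof (intro equalityI subsetI)
  fix j assume "j \<in> {Suc N - i..N} - {i}"
  then have "j \<in> {1..N}" "i \<noteq> j" "N < i + j" using assms by auto
  then show "j \<in> neighbours (antiregular N) i"
    using assms unfolding antiregular_def neighbours_def by blast
qed (auto simp: antiregular_def neighbours_def doubleton_eq_iff)

lemma degree_antiregular:
  assumes "i \<in> {1..N}"
  shows "degree (antiregular N) i = (if i \<le> N div 2 then i else i - 1)"
proof -
  have "i \<in> {Suc N - i..N} \<longleftrightarrow> \<not> i \<le> N div 2" using assms by auto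
  then show ?thesis
    using assms by (auto simp: degree_eq_card_neighbours[OF simple_graph_antiregular]
        neighbours_antiregular card_Diff_singleton_if)
qed

lemma card_antiregular: "card (antiregular N) = N div 2 * (N - N div 2)"
proof -
  define h where "h = N div 2"
  have h_le: "h \<le> N" by (simp add: h_def)
  have "2 * card (antiregular N) = (\<Sum>i\<in>{1..N}. degree (antiregular N) i)"
    by (rule sum_degree_eq_double_card_edges[OF simple_graph_antiregular, symmetric])
  also have "\<dots> = (\<Sum>i\<in>{1..h}. degree (antiregular N) i)
      + (\<Sum>i\<in>{Suc h..N}. degree (antiregular N) i)"
    using h_le by (subst sum.union_disjoint[symmetric]) (auto intro!: sum.cong)
  also have "(\<Sum>i\<in>{1..h}. degree (antiregular N) i) = \<Sum>{1..<1 + h}"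
    using h_le by (intro sum.cong) (auto simp: degree_antiregular h_def)
  also have "(\<Sum>i\<in>{Suc h..N}. degree (antiregular N) i) = \<Sum>{h..<h + (N - h)}"
    using h_le by (intro sum.reindex_bij_witness[of _ Suc "\<lambda>i. i - 1"])
      (auto simp: degree_antiregular h_def)
  also have "\<Sum>{1..<1 + h} + \<Sum>{h..<h + (N - h)}
      = h + (h choose 2) + (N - h) * h + (N - h choose 2)"
    by (simp only: sum_atLeastLessThan_add)
  also have "\<dots> = 2 * (h * (N - h))"
  proof -
    consider "N - h = h" | "N - h = Suc h" unfolding h_def by linarith
    moreover have "h + 2 * (h choose 2) = h * h" by (cases h) (simp_all add: choose_two)
    ultimately show ?thesis by cases (simp_all add: numeral_2_eq_2)
  qed
  finally show ?thesis by (simp add: h_def)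
qed

lemma image_degree_antiregular:
  assumes "1 \<le> m" and "m \<le> N div 2"
  shows "degree (antiregular N) ` ({m..N} - {Suc (N div 2)}) = {m..<N}"
proof (intro equalityI subsetI)
  fix d assume "d \<in> degree (antiregular N) ` ({m..N} - {Suc (N div 2)})"
  then show "d \<in> {m..<N}" using assms by (auto simp: degree_antiregular split: if_splits)
next
  fix d assume d: "d \<in> {m..<N}"
  define v where "v = (if d \<le> N div 2 then d else Suc d)"
  have v: "v \<in> {m..N} - {Suc (N div 2)}" using d by (auto simp: v_def)
  moreover have "degree (antiregular N) v = d"
    using v assms(1) by (auto simp: degree_antiregular v_def)
  ultimately show "d \<in> degree (antiregular N) ` ({m..N} - {Suc (N div 2)})" by blast
qed

lemma sum_diff_eq_choose:
  fixes m :: nat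
  shows "(\<Sum>v\<in>{1..<m}. m - v) = m choose 2"
proof -
  have "(\<Sum>v\<in>{1..<m}. m - v) = \<Sum>{1..<m}"
    by (rule sum.reindex_bij_witness[of _ "\<lambda>v. m - v" "\<lambda>v. m - v"]) auto
  also have "\<dots> = m choose 2"
    using sum_atLeastLessThan_add[of 0 m] by (simp add: sum_shift_lb_Suc0_0_upt)
  finally show ?thesis .
qed

lemma le_choose_Suc: "m \<le> Suc m choose 2"
  by (simp add: numeral_2_eq_2)

lemma antiregular_raise_small_degrees:
  assumes "1 \<le> m" and "Suc m choose 2 \<le> N div 2"
  obtains E where "simple_graph {1..N} E" "card E = card (antiregular N)"
    "\<And>v. v \<in> {1..<m} \<Longrightarrow> degree E v = m" "degree E (Suc (N div 2)) \<in> {m..N div 2}"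
    "\<And>v. v \<notin> insert (Suc (N div 2)) {1..<m} \<Longrightarrow> degree E v = degree (antiregular N) v"
proof -
  define k where "k = N div 2"
  have m_choose: "m + (m choose 2) \<le> k" using assms(2) by (simp add: k_def numeral_2_eq_2)
  then have k_bounds: "m \<le> k" "Suc k \<le> N" using assms(1) by (auto simp: k_def)
  have degree_small: "degree (antiregular N) v = v" if "v \<in> {1..<m}" for v
    using that k_bounds by (simp add: degree_antiregular k_def)
  have degree_Suc_k: "degree (antiregular N) (Suc k) = k"
    using k_bounds by (simp add: degree_antiregular k_def)
  have gain_le: "degree (antiregular N) v + (m - v) + (\<Sum>v\<in>{1..<m}. m - v)
      \<le> degree (antiregular N) (Suc k)" if "v \<in> {1..<m}" for v
    unfolding sum_diff_eq_choose degree_Suc_k degree_small[OF that] using that m_choose by simp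
  have "{1..<m} \<subseteq> {1..N}" "Suc k \<notin> {1..<m}" using k_bounds by auto
  then obtain E where E: "simple_graph {1..N} E" "card E = card (antiregular N)"
    "degree E (Suc k) + (m choose 2) = k"
    "\<And>v. v \<in> {1..<m} \<Longrightarrow> degree E v = degree (antiregular N) v + (m - v)"
    "\<And>v. v \<notin> insert (Suc k) {1..<m} \<Longrightarrow> degree E v = degree (antiregular N) v"
    using redistribute_degrees[OF finite_atLeastLessThan simple_graph_antiregular, where
        g = "\<lambda>v. m - v", OF _ _ gain_le]
    unfolding sum_diff_eq_choose degree_Suc_k by blast
  show thesis
  proof (rule that[folded k_def, OF E(1,2)])
    show "degree E v = m" if "v \<in> {1..<m}" for v
      using E(4)[OF that] degree_small[OF that] that by simp
    show "degree E (Suc k) \<in> {m..k}" using E(3) m_choose by auto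
  qed (rule E(5))
qed

lemma interval_degree_set_realization:
  assumes "1 \<le> m" and "Suc m choose 2 \<le> N div 2"
  obtains E where "simple_graph {1..N} E" "degree_set {1..N} E = {m..<N}"
    "card E = card (antiregular N)"
proof -
  obtain E where E: "simple_graph {1..N} E" "card E = card (antiregular N)"
    and degree_raised: "\<And>v. v \<in> {1..<m} \<Longrightarrow> degree E v = m"
    and degree_lowered: "degree E (Suc (N div 2)) \<in> {m..N div 2}"
    and degree_kept: "\<And>v. v \<notin> insert (Suc (N div 2)) {1..<m} \<Longrightarrow>
      degree E v = degree (antiregular N) v"
    using antiregular_raise_small_degrees[OF assms] by blast
  have m_le: "m \<le> N div 2" using le_choose_Suc assms(2) by (rule order_trans)
  define changed where "changed = insert (Suc (N div 2)) {1..<m}"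
  define kept where "kept = {m..N} - {Suc (N div 2)}"
  have vertices: "{1..N} = changed \<union> kept"
    using assms(1) m_le by (auto simp: changed_def kept_def)
  have "degree E ` kept = degree (antiregular N) ` kept"
    by (intro image_cong refl degree_kept) (auto simp: kept_def)
  also have "\<dots> = {m..<N}"
    unfolding kept_def by (rule image_degree_antiregular[OF assms(1) m_le])
  finally have "degree E ` kept = {m..<N}" .
  moreover have "degree E ` changed \<subseteq> {m..<N}"
    using degree_raised degree_lowered assms(1) m_le by (auto simp: changed_def)
  ultimately have "degree_set {1..N} E = {m..<N}"
    unfolding degree_set_def vertices image_Un by blast
  with E show thesis by (intro that)
qed

lemma lq_eq_cardI:
  fixes V :: "'a set"
  assumes "simple_graph V E" "degree_set V E = D"
    and "\<And>(V' :: nat set) E'. simple_graph V' E' \<Longrightarrow> degree_set V' E' = D \<Longrightarrow> card E \<le> card E'"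
  shows "lq D = card E"
  unfolding lq_def
proof (rule Least_equality)
  show "\<exists>(V' :: nat set) E'. simple_graph V' E' \<and> degree_set V' E' = D \<and> card E' = card E"
    using simple_graph_relabel_nat[OF assms(1)] assms(2) by simp
qed (use assms(3) in blast)

lemma lq_atLeastLessThan:
  assumes "1 \<le> m" and "Suc m choose 2 \<le> N div 2"
  shows "lq {m..<N} = N div 2 * (N - N div 2)"
proof -
  obtain E where E: "simple_graph {1..N} E" "degree_set {1..N} E = {m..<N}"
    "card E = card (antiregular N)"
    using interval_degree_set_realization[OF assms] .
  have card_E: "card E = N div 2 * (N - N div 2)" unfolding E(3) by (rule card_antiregular)
  have "m \<le> N div 2" using le_choose_Suc assms(2) by (rule order_trans)
  then have top_degrees: "{N - N div 2..<N - N div 2 + N div 2} \<subseteq> {m..<N}" by auto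
  have "lq {m..<N} = card E"
  proof (rule lq_eq_cardI[OF E(1,2)])
    fix V' :: "nat set" and E'
    assume graph: "simple_graph V' E'" and "degree_set V' E' = {m..<N}"
    with top_degrees have "{N - N div 2..<N - N div 2 + N div 2} \<subseteq> degree_set V' E'" by simp
    with graph show "card E \<le> card E'"
      unfolding card_E by (rule card_edges_ge_of_consecutive_degrees)
  qed
  with card_E show ?thesis by simp
qed

lemma ceiling_half_nat: "\<lceil>real n / 2\<rceil> = int (Suc n div 2)"
  by (rule ceiling_unique) linarith+

lemma quadruple_half_mult_half:
  fixes n :: nat
  shows "4 * (Suc n div 2 * (Suc n - Suc n div 2)) = n * Suc n + 2 * (Suc n div 2)"
  by (cases "even n") (auto elim!: evenE oddE simp: algebra_simps)

theorem theorem7: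
  fixes m n :: nat
  assumes "m \<ge> 1" and "n \<ge> 1"
    and "int (m * (m + 1)) < 2 * \<lceil>real n / 2\<rceil>"
  shows "lq {m..n} = lq {1..n} \<and>
    real (lq {1..n}) = 1 / 2 * (real n * (real n + 1) / 2 + real_of_int \<lceil>real n / 2\<rceil>)"
proof -
  define k where "k = Suc n div 2"
  have ceiling: "\<lceil>real n / 2\<rceil> = int k" by (simp add: ceiling_half_nat k_def)
  have lq_eq: "lq {l..n} = k * (Suc n - k)" if "1 \<le> l" "l * (l + 1) \<le> 2 * k" for l
    using that lq_atLeastLessThan[of l "Suc n"]
    by (simp add: choose_two k_def atLeastLessThanSuc_atLeastAtMost)
  have "m * (m + 1) \<le> 2 * k" using assms(3) unfolding ceiling by linarith
  with assms(1) have lq_m: "lq {m..n} = k * (Suc n - k)" by (rule lq_eq)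
  have "1 \<le> k" using assms(2) unfolding k_def by linarith
  then have lq_1: "lq {1..n} = k * (Suc n - k)" by (intro lq_eq) simp_all
  then have "4 * lq {1..n} = n * Suc n + 2 * k"
    by (simp only: quadruple_half_mult_half k_def)
  then have "real (4 * lq {1..n}) = real (n * Suc n + 2 * k)" by (rule arg_cong)
  then have "real (lq {1..n}) = 1 / 2 * (real n * (real n + 1) / 2 + real k)"
    by (simp add: field_simps)
  then show ?thesis unfolding lq_m lq_1 ceiling by simp
qed

end
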